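(* Let $f:[0,1]\to\mathbb{R}$ and $p\in(0,1)$ determine an $f$-belos with cusp $P=(p,0)$. For every $x_0\in(0,1)$, the parallelogram $\mathcal{P}(x_0)$ is a rectangle if and only if $f(x_0)^2=x_0-x_0^2$. Consequently, $\mathcal{P}(x_0)$ is a rectangle for every $x_0\in(0,1)$ if and only if the graph of $f$ is a semicircle, i.e. $f(x)=\sqrt{x-x^2}$ for all $x\in[0,1]$.
   Context: Let $f:[0,1]\to\mathbb{R}$ be continuous on $[0,1]$, differentiable on $(0,1)$, with $f(0)=f(1)=0$ and $f(x)>0$ for $x\in(0,1)$. Given $p\in(0,1)$, define $g:[0,p]\to\mathbb{R}$ by $g(x)=p\,f(x/p)$ and $h:[p,1]\to\mathbb{R}$ by $h(x)=(1-p)\,f\left(\frac{x-p}{1-p}\right)$. It is assumed that the graphs of $g$ and $h$ are below the graph of $f$, i.e. $g\le f$ on $[0,p]$ and $h\le f$ on $[p,1]$. The $f$-belos with cusp $P=(p,0)$ is the plane figure bounded above by the graph of $f$ and below by the graphs of $g$ and $h$. For $x_0\in(0,1)$ put $P_1=(x_0,f(x_0))$, $P_2=(px_0,\,pf(x_0))$ and $P_3=((1-p)x_0+p,\,(1-p)f(x_0))$ (corresponding points on the graphs of $f$, $g$, $h$). The quadrilateral $P_1P_2PP_3$ (vertices in this order) is a parallelogram, denoted $\mathcal{P}(x_0)$. *)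

theory Defs
  imports "HOL-Analysis.Analysis"
begin

definition belos_left :: "(real \<Rightarrow> real) \<Rightarrow> real \<Rightarrow> real \<Rightarrow> real" where
  "belos_left f p x = p * f (x / p)"

definition belos_right :: "(real \<Rightarrow> real) \<Rightarrow> real \<Rightarrow> real \<Rightarrow> real" where
  "belos_right f p x = (1 - p) * f ((x - p) / (1 - p))"

(* Only the values of f on [0,1] matter: the function is total merely by typing. *)
definition determines_belos :: "(real \<Rightarrow> real) \<Rightarrow> real \<Rightarrow> bool" where
  "determines_belos f p \<longleftrightarrow>
     p \<in> {0<..<1} \<and>
     continuous_on {0..1} f \<and>
     (\<forall>x\<in>{0<..<1}. f differentiable (at x)) \<and>
     f 0 = 0 \<and> f 1 = 0 \<and>
     (\<forall>x\<in>{0<..<1}. f x > 0) \<and>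
     (\<forall>x\<in>{0..p}. belos_left f p x \<le> f x) \<and>
     (\<forall>x\<in>{p..1}. belos_right f p x \<le> f x)"

definition belos_cusp :: "real \<Rightarrow> real \<times> real" where
  "belos_cusp p = (p, 0)"

definition belos_P1 :: "(real \<Rightarrow> real) \<Rightarrow> real \<Rightarrow> real \<times> real" where
  "belos_P1 f x0 = (x0, f x0)"

definition belos_P2 :: "(real \<Rightarrow> real) \<Rightarrow> real \<Rightarrow> real \<Rightarrow> real \<times> real" where
  "belos_P2 f p x0 = (p * x0, p * f x0)"

definition belos_P3 :: "(real \<Rightarrow> real) \<Rightarrow> real \<Rightarrow> real \<Rightarrow> real \<times> real" where
  "belos_P3 f p x0 = ((1 - p) * x0 + p, (1 - p) * f x0)"

(* Vertices in cyclic order; degenerate parallelograms are excluded. *)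
definition is_parallelogram ::
    "real \<times> real \<Rightarrow> real \<times> real \<Rightarrow> real \<times> real \<Rightarrow> real \<times> real \<Rightarrow> bool" where
  "is_parallelogram A B C D \<longleftrightarrow> \<not> collinear {A, B, C} \<and> B - A = C - D"

definition is_rectangle ::
    "real \<times> real \<Rightarrow> real \<times> real \<Rightarrow> real \<times> real \<Rightarrow> real \<times> real \<Rightarrow> bool" where
  "is_rectangle A B C D \<longleftrightarrow>
     is_parallelogram A B C D \<and>
     orthogonal (D - A) (B - A) \<and> orthogonal (A - B) (C - B) \<and>
     orthogonal (B - C) (D - C) \<and> orthogonal (C - D) (A - D)"

definition belos_rectangle :: "(real \<Rightarrow> real) \<Rightarrow> real \<Rightarrow> real \<Rightarrow> bool" where
  "belos_rectangle f p x0 \<longleftrightarrow>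
     is_rectangle (belos_P1 f x0) (belos_P2 f p x0) (belos_cusp p) (belos_P3 f p x0)"

definition unit_graph :: "(real \<Rightarrow> real) \<Rightarrow> (real \<times> real) set" where
  "unit_graph f = (\<lambda>x. (x, f x)) ` {0..1}"

(* A closed half (endpoints included) of a circle with centre c and radius r, cut off
   by the line through c orthogonal to u. *)
definition is_semicircle :: "(real \<times> real) set \<Rightarrow> bool" where
  "is_semicircle S \<longleftrightarrow>
     (\<exists>c r u. r > 0 \<and> u \<noteq> 0 \<and> S = {q \<in> sphere c r. (q - c) \<bullet> u \<ge> 0})"

end

theory Submission
  imports Defs
begin

text \<open>The sides of the parallelogram are parallel to the segments from \<open>P1\<close> to
  (0,0) and to (1,0): its side vectors are, up to sign, (1-p)(x0, f x0) and p(1-x0, -f x0). By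
  Thales, they are orthogonal exactly when \<open>P1\<close> lies on the circle with diameter [0,1]
  (\<open>belos_rectangle_iff\<close>). If this holds for every x0, positivity of f selects the
  upper half circle. Conversely, a graph over [0,1] that is a half circle of any position and
  direction and meets the axis at 0 and 1 must lie on that same circle
  (\<open>semicircle_unit_graph_imp_circle\<close>).\<close>

lemma not_collinear_if_cross_nonzero:
  fixes A B C :: "real \<times> real"
  assumes "fst (A - B) * snd (C - B) - snd (A - B) * fst (C - B) \<noteq> 0"
  shows "\<not> collinear {A, B, C}"
proof
  assume "collinear {A, B, C}"
  then obtain u where u: "\<And>x y. x \<in> {A, B, C} \<Longrightarrow> y \<in> {A, B, C} \<Longrightarrow> \<exists>c. x - y = c *\<^sub>R u"
    unfolding collinear_def by blast
  obtain a where "A - B = a *\<^sub>R u" using u[of A B] by blast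
  moreover obtain c where "C - B = c *\<^sub>R u" using u[of C B] by blast
  ultimately show False using assms by simp
qed

text \<open>The side vectors at \<open>P2\<close> have determinant -p(1-p) f(x0), so positivity of f
  rules out degeneracy.\<close>

lemma belos_parallelogram:
  assumes "p \<in> {0<..<1}" and "f x0 > 0"
  shows "is_parallelogram (belos_P1 f x0) (belos_P2 f p x0) (belos_cusp p) (belos_P3 f p x0)"
proof -
  have "((1 - p) * x0) * (- p * f x0) - ((1 - p) * f x0) * (p - p * x0) = - ((1 - p) * p * f x0)"
    by algebra
  also have "\<dots> \<noteq> 0"
    using assms by simp
  finally have "\<not> collinear {belos_P1 f x0, belos_P2 f p x0, belos_cusp p}"
    by (intro not_collinear_if_cross_nonzero)
      (simp add: belos_P1_def belos_P2_def belos_cusp_def algebra_simps)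
  then show ?thesis
    by (simp add: is_parallelogram_def belos_P1_def belos_P2_def belos_P3_def belos_cusp_def
        algebra_simps)
qed

lemma belos_rectangle_iff:
  assumes "p \<in> {0<..<1}" and "f x0 > 0"
  shows "belos_rectangle f p x0 \<longleftrightarrow> (f x0)\<^sup>2 = x0 - x0\<^sup>2"
proof -
  define E where "E = x0 - x0\<^sup>2 - (f x0)\<^sup>2"
  define A where "A = belos_P1 f x0"
  define B where "B = belos_P2 f p x0"
  define C where "C = belos_cusp p"
  define D where "D = belos_P3 f p x0"
  note defs = A_def B_def C_def D_def belos_P1_def belos_P2_def belos_P3_def belos_cusp_def
  \<comment> \<open>Opposite sides are equal vectors, so the four corner products agree up to sign
    and all four right angles reduce to E = 0.\<close>
  have "(D - A) \<bullet> (B - A) = - (p * (1 - p) * E)" "(A - B) \<bullet> (C - B) = p * (1 - p) * E"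
    "(B - C) \<bullet> (D - C) = - (p * (1 - p) * E)" "(C - D) \<bullet> (A - D) = p * (1 - p) * E"
    unfolding defs E_def by (simp_all add: inner_prod_def) algebra+
  moreover have "p * (1 - p) \<noteq> 0"
    using assms by simp
  ultimately have "belos_rectangle f p x0 \<longleftrightarrow> E = 0"
    using belos_parallelogram[of p f x0] assms
    unfolding belos_rectangle_def is_rectangle_def orthogonal_def
    by (fold A_def B_def C_def D_def) auto
  then show ?thesis
    unfolding E_def by auto
qed

lemma mem_sphere_Pair:
  fixes x y a b r :: real
  assumes "r \<ge> 0"
  shows "(x, y) \<in> sphere (a, b) r \<longleftrightarrow> (x - a)\<^sup>2 + (y - b)\<^sup>2 = r\<^sup>2"
proof -
  have "dist (a, b) (x, y) = sqrt ((x - a)\<^sup>2 + (y - b)\<^sup>2)"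
    by (simp add: dist_Pair_Pair dist_real_def power2_commute)
  then show ?thesis
    using assms by (auto simp: real_sqrt_eq_iff real_sqrt_unique)
qed

text \<open>Being a graph forces the bounding diameter to be horizontal; the diameter then has to
  fit over [0,1], while the circle passes through (0,0) and (1,0), which leaves one circle. The
  upper and the lower half are both possible here, hence the squared conclusion.\<close>

lemma semicircle_unit_graph_imp_circle:
  assumes "is_semicircle (unit_graph f)" and "f 0 = 0" and "f 1 = 0" and "x \<in> {0..1}"
  shows "(f x)\<^sup>2 = x - x\<^sup>2"
proof -
  from assms(1) obtain c r w where r: "r > 0"
    and "unit_graph f = {q \<in> sphere c r. (q - c) \<bullet> w \<ge> 0}"
    unfolding is_semicircle_def by blast
  moreover obtain a b u v where "c = (a, b)" "w = (u, v)"
    by (meson surj_pair)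
  ultimately have S: "unit_graph f = {q \<in> sphere (a, b) r. (q - (a, b)) \<bullet> (u, v) \<ge> 0}"
    by simp
  \<comment> \<open>From right to left, each point of the half circle has its abscissa in [0,1] and
    is the only one on its vertical line.\<close>
  have graph_iff: "x \<in> {0..1} \<and> y = f x \<longleftrightarrow>
      (x - a)\<^sup>2 + (y - b)\<^sup>2 = r\<^sup>2 \<and> (x - a) * u + (y - b) * v \<ge> 0" for x y
  proof -
    have "x \<in> {0..1} \<and> y = f x \<longleftrightarrow> (x, y) \<in> unit_graph f"
      unfolding unit_graph_def by auto
    then show ?thesis
      unfolding S using r by (simp add: mem_sphere_Pair inner_prod_def del: mem_sphere)
  qed
  \<comment> \<open>If the axis were not vertical, an endpoint of the bounding diameter and its mirror image
    in the horizontal line through the centre would be two points of the graph on one vertical.\<close>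
  have "u = 0"
  proof (rule ccontr)
    assume "u \<noteq> 0"
    define N where "N = sqrt (u\<^sup>2 + v\<^sup>2)"
    have N: "N > 0" "N\<^sup>2 = u\<^sup>2 + v\<^sup>2"
      using \<open>u \<noteq> 0\<close> by (simp_all add: N_def sum_power2_gt_zero_iff)
    define d where "d = r / N"
    have d: "d > 0" "d\<^sup>2 * (u\<^sup>2 + v\<^sup>2) = r\<^sup>2"
      using N r by (simp_all add: d_def power_divide flip: N(2))
    \<comment> \<open>The vector d(-v, u) runs along the bounding diameter and has length r. The
      sign of its horizontal part is chosen to agree with u, so that for both vertical offsets d u
      and -d u the product with (u, v) is d(|u||v| + e u v), which is nonnegative.\<close>
    define x where "x = a + d * (sgn u * \<bar>v\<bar>)"
    have sq: "(x - a)\<^sup>2 + (d * u)\<^sup>2 = r\<^sup>2"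
      using d(2) \<open>u \<noteq> 0\<close> by (simp add: x_def power_mult_distrib algebra_simps sgn_if)
    have half: "(x - a) * u + (e * (d * u)) * v \<ge> 0" if "e = 1 \<or> e = - 1" for e
    proof -
      have "(x - a) * u + (e * (d * u)) * v = d * (\<bar>u\<bar> * \<bar>v\<bar> + e * (u * v))"
        by (simp add: x_def algebra_simps abs_sgn)
      also have "\<dots> \<ge> 0"
        using d(1) that abs_ge_self[of "u * v"] abs_ge_minus_self[of "u * v"]
        by (auto simp: abs_mult)
      finally show ?thesis .
    qed
    have "b + d * u = f x"
      using graph_iff[of x "b + d * u"] sq half[of 1] by simp
    moreover have "b - d * u = f x"
      using graph_iff[of x "b - d * u"] sq half[of "- 1"] by simp
    ultimately have "d * u = 0"
      by linarith
    then show False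
      using d(1) \<open>u \<noteq> 0\<close> by simp
  qed
  \<comment> \<open>With a vertical axis, both ends (a - r, b) and (a + r, b) of the diameter belong
    to the graph.\<close>
  then have "a - r \<ge> 0" "a + r \<le> 1"
    using graph_iff[of "a - r" b] graph_iff[of "a + r" b] by auto
  moreover have at0: "a\<^sup>2 + b\<^sup>2 = r\<^sup>2" and at1: "(1 - a)\<^sup>2 + b\<^sup>2 = r\<^sup>2"
    using graph_iff[of 0 0] graph_iff[of 1 0] assms(2,3) by simp_all
  moreover have a: "a = 1 / 2"
    using at0 at1 by (simp add: power2_eq_square algebra_simps)
  \<comment> \<open>The diameter has length at most 1, but \<open>at0\<close> gives r^2 = 1/4 + b^2;
    so b = 0 and r = 1/2.\<close>
  ultimately have "r\<^sup>2 \<le> (1 / 2)\<^sup>2"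
    using r by (intro power_mono) auto
  then have "b = 0" "r\<^sup>2 = (1 / 2)\<^sup>2"
    using at0 unfolding a by (smt (verit) zero_le_power2 zero_eq_power2)+
  moreover have "(x - a)\<^sup>2 + (f x - b)\<^sup>2 = r\<^sup>2"
    using graph_iff[of x "f x"] assms(4) by simp
  ultimately show ?thesis
    unfolding a by (simp add: power2_eq_square algebra_simps)
qed

lemma is_semicircle_unit_graph_sqrt:
  assumes "\<And>x. x \<in> {0..1} \<Longrightarrow> f x = sqrt (x - x\<^sup>2)"
  shows "is_semicircle (unit_graph f)"
proof -
  have "(x, y) \<in> unit_graph f \<longleftrightarrow>
      (x, y) \<in> sphere (1 / 2, 0) (1 / 2) \<and> ((x, y) - (1 / 2, 0)) \<bullet> (0, 1) \<ge> 0" for x y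
  proof -
    have "(x, y) \<in> unit_graph f \<longleftrightarrow> x \<in> {0..1} \<and> y = sqrt (x - x\<^sup>2)"
      unfolding unit_graph_def using assms by auto
    \<comment> \<open>The domain condition is absorbed: y^2 = x - x^2 forces x(1 - x) to be
      nonnegative, that is, x in [0,1].\<close>
    also have "\<dots> \<longleftrightarrow> y\<^sup>2 = x - x\<^sup>2 \<and> y \<ge> 0"
    proof -
      have "x \<in> {0..1} \<longleftrightarrow> x - x\<^sup>2 \<ge> 0"
      proof -
        have "x - x\<^sup>2 = x * (1 - x)"
          by (simp add: power2_eq_square algebra_simps)
        then show ?thesis
          by (auto simp: zero_le_mult_iff)
      qed
      then show ?thesis
        by (metis real_sqrt_ge_zero real_sqrt_pow2 real_sqrt_unique zero_le_power2)
    qed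
    also have "\<dots> \<longleftrightarrow> (x - 1 / 2)\<^sup>2 + (y - 0)\<^sup>2 = (1 / 2)\<^sup>2 \<and> y \<ge> 0"
      by (auto simp: power2_eq_square algebra_simps)
    finally show ?thesis
      by (simp add: mem_sphere_Pair inner_prod_def del: mem_sphere)
  qed
  then have "unit_graph f =
      {q \<in> sphere (1 / 2, 0) (1 / 2). (q - (1 / 2, 0)) \<bullet> (0, 1) \<ge> 0}"
    by (intro set_eqI) (metis (mono_tags, lifting) mem_Collect_eq surj_pair)
  moreover have "(0, 1) \<noteq> (0 :: real \<times> real)" "(1 / 2 :: real) > 0"
    by (simp_all add: zero_prod_def)
  ultimately show ?thesis
    unfolding is_semicircle_def by blast
qed

theorem mainTheorem1:
  fixes f :: "real \<Rightarrow> real" and p :: real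
  assumes "determines_belos f p"
  shows "(\<forall>x0\<in>{0<..<1}. belos_rectangle f p x0 \<longleftrightarrow> (f x0)\<^sup>2 = x0 - x0\<^sup>2) \<and>
    ((\<forall>x0\<in>{0<..<1}. belos_rectangle f p x0) \<longleftrightarrow> is_semicircle (unit_graph f)) \<and>
    (is_semicircle (unit_graph f) \<longleftrightarrow> (\<forall>x\<in>{0..1}. f x = sqrt (x - x\<^sup>2)))"
proof -
  have p: "p \<in> {0<..<1}" and f0: "f 0 = 0" and f1: "f 1 = 0"
    and pos: "\<And>x. x \<in> {0<..<1} \<Longrightarrow> f x > 0"
    using assms unfolding determines_belos_def by blast+
  have rect: "\<forall>x0\<in>{0<..<1}. belos_rectangle f p x0 \<longleftrightarrow> (f x0)\<^sup>2 = x0 - x0\<^sup>2"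
    using belos_rectangle_iff[OF p] pos by blast
  \<comment> \<open>Positivity of f picks the square root on the open interval; at the endpoints
    both sides vanish.\<close>
  have circle_imp_sqrt: "\<forall>x\<in>{0..1}. f x = sqrt (x - x\<^sup>2)"
    if "\<forall>x\<in>{0<..<1}. (f x)\<^sup>2 = x - x\<^sup>2"
  proof
    fix x :: real
    assume "x \<in> {0..1}"
    then consider "x = 0" | "x = 1" | "x \<in> {0<..<1}"
      by force
    then show "f x = sqrt (x - x\<^sup>2)"
    proof cases
      case 3
      then show ?thesis
        using that pos[OF 3] by (metis less_imp_le real_sqrt_unique)
    qed (simp_all add: f0 f1)
  qed
  have semicircle_imp_circle: "\<forall>x\<in>{0<..<1}. (f x)\<^sup>2 = x - x\<^sup>2"
    if "is_semicircle (unit_graph f)"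
    using semicircle_unit_graph_imp_circle[OF that f0 f1] by simp
  show ?thesis
    using rect circle_imp_sqrt semicircle_imp_circle is_semicircle_unit_graph_sqrt[of f] by blast
qed

end
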